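(* For every integer $n\ge0$, the second order Padé approximant ${}_{[1|1]}B_n(x)$ of the Bernoulli polynomial has the umbral explicit representation $$ {}_{[1|1]}B_n(x)=e_n\!\left(x,\tfrac{\hat B}{2}\right)\phi_0+\frac n2\,\hat B\,e_{n-1}\!\left(x,\tfrac{\hat B}{2}\right)\phi_0 . $$
   Context: Umbral notation: $\hat B$ is a formal symbol; for a polynomial (or formal power series with a polynomial-type expansion) in $\hat B$, applying it to $\phi_0$ means replacing, linearly, each power $\hat B^r$ by $\hat B^r\phi_0=B_r$ (after all multiplications by $\hat B$ have been carried out), where $B_r$ are the Bernoulli numbers, $\frac{t}{e^t-1}=\sum_{r\ge0}B_r\frac{t^r}{r!}$, $|t|<2\pi$. Thus the amplitude of the Bernoulli polynomials has the umbral form $\frac{t}{e^t-1}=e^{\hat Bt}\phi_0$, and the Bernoulli polynomials are $B_n(x)=(\hat B+x)^n\phi_0$. The $[1|1]$ Padé approximant of $e^{-s}$ is the rational function with numerator and denominator of degree at most $1$, denominator equal to $1$ at $0$, whose derivatives at $0$ of orders $0,1,2$ agree with those of $e^{-s}$; explicitly ${}_{[1|1]}e^{-s}=\frac{1-\frac12s}{1+\frac12s}$. The Padé approximant ${}_{[1|1]}B_n(x)$ is taken at the level of the umbral image (substituting $s=-\hat Bt$): the approximated amplitude is ${}_{[1|1]}A(t)={}_{[1|1]}e^{\hat Bt}\phi_0=\frac{1+\frac{\hat B}{2}t}{1-\frac{\hat B}{2}t}\phi_0$, understood as a formal power series in $t$ with coefficients polynomial in $\hat B$, evaluated on $\phi_0$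 coefficientwise, and $${}_{[1|1]}B_n(x)={}_{[1|1]}A(\partial_x)\{x^n\}=\frac{1+\frac{\hat B}{2}\partial_x}{1-\frac{\hat B}{2}\partial_x}\{x^n\}\,\phi_0,\qquad \partial_x=\frac{d}{dx}.$$ First order two-variable truncated exponential polynomials: $e_n(x,y)=n!\sum_{r=0}^n\frac{x^{n-r}y^r}{(n-r)!}$ for $n\ge0$; for $n=0$ the term with $e_{n-1}$ is zero. *)

theory Defs
  imports "HOL-Computational_Algebra.Computational_Algebra"
begin

section \<open>Bernoulli numbers and umbral evaluation\<close>

definition bernoulli :: "nat \<Rightarrow> real" where
  "bernoulli r = fact r * fps_nth (fps_X / (fps_exp 1 - 1)) r"

lemma bernoulli_gf:
  "Abs_fps (\<lambda>r. bernoulli r / fact r) * (fps_exp 1 - 1) = fps_X"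
proof -
  let ?g = "fps_exp (1::real) - 1"
  have g1: "fps_nth ?g 1 = 1" by simp
  have "fps_nth ?g 0 = 0" by simp
  have nz: "?g \<noteq> 0"
    using g1 by (metis fps_zero_nth zero_neq_one)
  have sd: "subdegree ?g = 1"
    by (rule subdegreeI) auto
  have "?g dvd fps_X"
    using nz sd by (subst fps_dvd_iff) auto
  moreover have "Abs_fps (\<lambda>r. bernoulli r / fact r) = fps_X / ?g"
    by (simp add: fps_eq_iff bernoulli_def)
  ultimately show ?thesis by simp
qed

text \<open>
  A polynomial in the umbral symbol is an element of \<^typ>\<open>real poly\<close>, the indeterminate being
  the symbol itself. Evaluation on the vacuum replaces its \<open>r\<close>-th power by the \<open>r\<close>-th
  Bernoulli number.
\<close>

definition umbral_eval :: "real poly \<Rightarrow> real" where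
  "umbral_eval p = (\<Sum>r\<le>degree p. coeff p r * bernoulli r)"

abbreviation B_hat :: "real poly" where
  "B_hat \<equiv> [:0, 1:]"

lemma umbral_eval_0 [simp]: "umbral_eval 0 = 0"
  by (simp add: umbral_eval_def)

lemma umbral_eval_bound:
  assumes "degree p \<le> N"
  shows "umbral_eval p = (\<Sum>r\<le>N. coeff p r * bernoulli r)"
  unfolding umbral_eval_def
  by (rule sum.mono_neutral_left) (use assms in \<open>auto simp: not_le coeff_eq_0\<close>)

lemma umbral_eval_add: "umbral_eval (p + q) = umbral_eval p + umbral_eval q"
proof -
  let ?N = "max (degree p) (degree q)"
  have "degree (p + q) \<le> ?N" by (rule degree_add_le_max)
  then show ?thesis
    by (simp add: umbral_eval_bound[of _ ?N] sum.distrib ring_distribs)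
qed

lemma umbral_eval_smult: "umbral_eval (smult c p) = c * umbral_eval p"
  by (subst umbral_eval_bound[of _ "degree p"])
     (auto simp: umbral_eval_def sum_distrib_left mult.assoc)

lemma umbral_eval_B_hat_power: "umbral_eval (B_hat ^ r) = bernoulli r"
proof -
  have "umbral_eval (monom 1 r) = bernoulli r"
    by (simp add: umbral_eval_def degree_monom_eq if_distrib[of "\<lambda>c. c * _"] cong: if_cong)
  then show ?thesis by (simp add: monom_altdef)
qed

text \<open>
  Polynomials in \<open>x\<close> whose coefficients are polynomials in the umbral symbol have type
  \<^typ>\<open>real poly poly\<close>, with \<open>x\<close> as the outer indeterminate.
\<close>

definition umbral_eval_poly :: "real poly poly \<Rightarrow> real poly" where
  "umbral_eval_poly p = map_poly umbral_eval p"


section \<open>Pade approximants\<close>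

text \<open>
  A rational function whose denominator is \<open>1\<close> at \<open>0\<close> is identified with its power series at
  \<open>0\<close>; this makes the approximant independent of the choice of numerator and denominator.
\<close>

definition is_pade :: "nat \<Rightarrow> nat \<Rightarrow> real fps \<Rightarrow> real fps \<Rightarrow> bool" where
  "is_pade m k F R \<longleftrightarrow>
     (\<exists>p q. degree p \<le> m \<and> degree q \<le> k \<and> poly q 0 = 1 \<and>
            R = fps_of_poly p / fps_of_poly q) \<and>
     (\<forall>j\<le>m + k. fps_nth ((fps_deriv ^^ j) R) 0 = fps_nth ((fps_deriv ^^ j) F) 0)"

definition pade :: "nat \<Rightarrow> nat \<Rightarrow> real fps \<Rightarrow> real fps" where
  "pade m k F = (THE R. is_pade m k F R)"

lemma is_pade_11_exp_iff:
  "is_pade 1 1 (fps_exp (-1)) R \<longleftrightarrow>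
     R = (1 - fps_const (1/2) * fps_X) / (1 + fps_const (1/2) * fps_X)"
  (is "_ \<longleftrightarrow> R = ?P / ?Q")
proof -
  have lin: "fps_of_poly [:a, b:] = fps_const a + fps_const b * fps_X" for a b :: real
    by (simp add: fps_of_poly_pCons mult.commute)
  have char: "R = fps_of_poly [:a, b:] / fps_of_poly [:1, c:] \<longleftrightarrow>
      R * (1 + fps_const c * fps_X) = fps_const a + fps_const b * fps_X" for a b c
  proof -
    have u: "fps_nth (1 + fps_const c * fps_X) 0 \<noteq> 0" by simp
    then have inv: "(1 + fps_const c * fps_X) * inverse (1 + fps_const c * fps_X) = 1"
      by (simp add: inverse_mult_eq_1')
    let ?D = "1 + fps_const c * fps_X" and ?N = "fps_const a + fps_const b * fps_X"
    have "R = ?N * inverse ?D \<longleftrightarrow> R * ?D = ?N"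
    proof
      assume "R = ?N * inverse ?D"
      then have "R * ?D = ?N * (?D * inverse ?D)" by (simp only: mult_ac)
      then show "R * ?D = ?N" by (simp only: inv mult_1_right)
    next
      assume "R * ?D = ?N"
      then have "?N * inverse ?D = R * (?D * inverse ?D)" by (metis mult.assoc)
      then show "R = ?N * inverse ?D" by (simp only: inv mult_1_right)
    qed
    then show ?thesis
      unfolding lin fps_const_1_eq_1 by (simp only: fps_divide_unit[OF u])
  qed
  have nth: "fps_nth (R * (1 + fps_const c * fps_X)) j =
      fps_nth R j + (if j = 0 then 0 else c * fps_nth R (j - 1))" for c j
  proof -
    have "R * (1 + fps_const c * fps_X) = R + fps_const c * (R * fps_X)"
      by (simp add: algebra_simps)
    then show ?thesis by simp
  qed
  have derivs: "(\<forall>j\<le>1 + 1. fps_nth ((fps_deriv ^^ j) R) 0 =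
                    fps_nth ((fps_deriv ^^ j) (fps_exp (-1 :: real))) 0) \<longleftrightarrow>
      fps_nth R 0 = 1 \<and> fps_nth R 1 = -1 \<and> fps_nth R 2 = 1/2"
  proof -
    have "(\<forall>j\<le>1 + 1. P j) \<longleftrightarrow> P 0 \<and> P 1 \<and> P (2::nat)" for P
      by (auto simp: le_Suc_eq numeral_2_eq_2)
    then show ?thesis
      unfolding fps_0th_higher_deriv by (simp add: fact_numeral field_simps)
  qed
  have PQ: "?P / ?Q = fps_of_poly [:1, -1/2:] / fps_of_poly [:1, 1/2:]"
    unfolding lin by (simp flip: fps_const_neg)
  have eq: "R = ?P / ?Q \<longleftrightarrow>
      R * (1 + fps_const (1/2) * fps_X) = fps_const 1 + fps_const (-1/2) * fps_X"
    unfolding PQ by (rule char)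
  show ?thesis
  proof
    assume *: "is_pade 1 1 (fps_exp (-1)) R"
    then obtain p q where pq: "degree p \<le> 1" "degree q \<le> 1" "poly q 0 = 1"
        "R = fps_of_poly p / fps_of_poly q"
      and d: "fps_nth R 0 = 1" "fps_nth R 1 = -1" "fps_nth R 2 = 1/2"
      unfolding is_pade_def derivs by blast
    define a b c where "a = coeff p 0" and "b = coeff p 1" and "c = coeff q 1"
    have p: "p = [:a, b:]"
      by (rule poly_eqI) (use pq(1) in \<open>auto simp: a_def b_def coeff_pCons coeff_eq_0 split: nat.split\<close>)
    have q: "q = [:1, c:]"
      by (rule poly_eqI) (use pq(2,3) in
          \<open>auto simp: c_def poly_0_coeff_0 coeff_pCons coeff_eq_0 split: nat.split\<close>)
    have rel: "R * (1 + fps_const c * fps_X) = fps_const a + fps_const b * fps_X"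
      using pq(4) char unfolding p q by blast
    have "a = 1" using arg_cong[OF rel, of "\<lambda>f. fps_nth f 0"] d unfolding nth by simp
    moreover have "c - 1 = b"
      using arg_cong[OF rel, of "\<lambda>f. fps_nth f 1"] d unfolding nth by simp
    moreover have "1/2 - c = 0"
      using arg_cong[OF rel, of "\<lambda>f. fps_nth f 2"] d unfolding nth by simp
    ultimately have abc: "a = 1" "c = 1/2" "b = -1/2" by auto
    show "R = ?P / ?Q" unfolding eq using rel unfolding abc .
  next
    assume R: "R = ?P / ?Q"
    then have rel: "R * (1 + fps_const (1/2) * fps_X) = fps_const 1 + fps_const (-1/2) * fps_X"
      using eq by blast
    have d0: "fps_nth R 0 = 1" using arg_cong[OF rel, of "\<lambda>f. fps_nth f 0"] unfolding nth by simp
    have d1: "fps_nth R 1 = -1"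
      using arg_cong[OF rel, of "\<lambda>f. fps_nth f 1"] d0 unfolding nth by simp
    have d2: "fps_nth R 2 = 1/2"
      using arg_cong[OF rel, of "\<lambda>f. fps_nth f 2"] d1 unfolding nth by simp
    have "degree [:1, -1/2::real:] \<le> 1 \<and> degree [:1, 1/2::real:] \<le> 1 \<and> poly [:1, 1/2::real:] 0 = 1 \<and>
          R = fps_of_poly [:1, -1/2:] / fps_of_poly [:1, 1/2:]"
      using R PQ by simp
    then show "is_pade 1 1 (fps_exp (-1)) R"
      unfolding is_pade_def derivs using d0 d1 d2 by blast
  qed
qed

lemma pade_11_exp:
  "pade 1 1 (fps_exp (-1)) = (1 - fps_const (1/2) * fps_X) / (1 + fps_const (1/2) * fps_X)"
  unfolding pade_def is_pade_11_exp_iff by simp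


section \<open>Pade approximants of the Bernoulli polynomials\<close>

text \<open>
  Power series in \<open>t\<close> with coefficients polynomial in the umbral symbol have type
  \<^typ>\<open>real poly fps\<close>. The approximant is composed with \<open>s = -B_hat t\<close>.
\<close>

definition pade11_amplitude_umbral :: "real poly fps" where
  "pade11_amplitude_umbral =
     fps_compose (Abs_fps (\<lambda>j. [:fps_nth (pade 1 1 (fps_exp (-1))) j:]))
                 (- (fps_const B_hat * fps_X))"

definition pade11_amplitude :: "real fps" where
  "pade11_amplitude = Abs_fps (\<lambda>j. umbral_eval (fps_nth pade11_amplitude_umbral j))"

lemma pade11_amplitude_umbral_rational:
  "pade11_amplitude_umbral * (1 - fps_const (smult (1/2) B_hat) * fps_X) =
     1 + fps_const (smult (1/2) B_hat) * fps_X"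
proof -
  define R :: "real fps" where
    "R = (1 - fps_const (1/2) * fps_X) / (1 + fps_const (1/2) * fps_X)"
  let ?A = "Abs_fps (\<lambda>j. [:fps_nth R j:])"
  let ?s = "- (fps_const B_hat * fps_X)"
  have u: "fps_nth (1 + fps_const (1/2) * fps_X :: real fps) 0 \<noteq> 0" by simp
  have rel: "R * (1 + fps_const (1/2) * fps_X) = 1 - fps_const (1/2) * fps_X"
    by (simp add: R_def fps_divide_unit[OF u] mult.assoc inverse_mult_eq_1[OF u])
  have rel': "R + fps_const (1/2) * (R * fps_X) = 1 - fps_const (1/2) * fps_X"
    using rel by (simp only: distrib_left mult_1_right mult.left_commute)
  have relj: "fps_nth R j + (1/2) * (if j = 0 then 0 else fps_nth R (j - 1)) =
      (if j = 0 then 1 else if j = 1 then -1/2 else 0)" for j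
    using arg_cong[OF rel', of "\<lambda>f. fps_nth f j"] by (simp split: if_splits)
  have "?A + fps_const [:1/2:] * (?A * fps_X) = 1 - fps_const [:1/2:] * fps_X"
  proof (rule fps_ext)
    fix j
    show "fps_nth (?A + fps_const [:1/2:] * (?A * fps_X)) j =
          fps_nth (1 - fps_const [:1/2:] * fps_X) j"
      using relj[of j] by (cases "j = 0"; cases "j = 1") (simp_all add: one_pCons)
  qed
  then have A: "?A * (1 + fps_const [:1/2:] * fps_X) = 1 - fps_const [:1/2:] * fps_X"
    by (simp add: algebra_simps)
  have s0: "fps_nth ?s 0 = 0" by simp
  have "fps_compose (?A * (1 + fps_const [:1/2:] * fps_X)) ?s
      = fps_compose (1 - fps_const [:1/2:] * fps_X) ?s"
    by (simp only: A)
  moreover have "fps_compose (?A * (1 + fps_const [:1/2:] * fps_X)) ?s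
      = fps_compose ?A ?s * (1 + fps_const [:1/2:] * ?s)"
    by (simp only: fps_compose_mult_distrib[OF s0] fps_compose_add_distrib fps_compose_1
        fps_const_compose fps_X_fps_compose_startby0[OF s0])
  moreover have "fps_compose (1 - fps_const [:1/2:] * fps_X) ?s = 1 - fps_const [:1/2:] * ?s"
    by (simp only: fps_compose_mult_distrib[OF s0] fps_compose_sub_distrib fps_compose_1
        fps_const_compose fps_X_fps_compose_startby0[OF s0])
  ultimately have c: "fps_compose ?A ?s * (1 + fps_const [:1/2:] * ?s) =
      1 - fps_const [:1/2:] * ?s"
    by (simp only:)
  have "fps_const [:1/2:] * ?s = - (fps_const (smult (1/2) B_hat) * fps_X)"
  proof -
    have "fps_const [:1/2:] * ?s = - (fps_const ([:1/2:] * B_hat) * fps_X)"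
      by (simp only: fps_const_mult[symmetric] mult.assoc mult_minus_right)
    then show ?thesis by simp
  qed
  with c show ?thesis
    unfolding pade11_amplitude_umbral_def pade_11_exp R_def[symmetric]
    by (simp only: add_uminus_conv_diff diff_minus_eq_add)
qed

text \<open>
  The operator \<open>A(d/dx)\<close> on polynomials: derivatives of order above the degree vanish, so the
  series terminates.
\<close>

definition apply_diff_series :: "'a::idom fps \<Rightarrow> 'a poly \<Rightarrow> 'a poly" where
  "apply_diff_series A p = (\<Sum>j\<le>degree p. smult (fps_nth A j) ((pderiv ^^ j) p))"

definition pade11_bernpoly :: "nat \<Rightarrow> real poly" where
  "pade11_bernpoly n = apply_diff_series pade11_amplitude (monom 1 n)"


section \<open>Truncated exponential polynomials\<close>

text \<open>Outer indeterminate \<open>x\<close>, inner indeterminate \<open>y\<close>.\<close>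

definition trunc_exp2 :: "nat \<Rightarrow> real poly poly" where
  "trunc_exp2 n = smult (fact n) (\<Sum>r\<le>n. monom (monom (1 / fact (n - r)) r) (n - r))"

lemma poly_trunc_exp2:
  "poly (poly (trunc_exp2 n) [:x:]) y = fact n * (\<Sum>r\<le>n. x ^ (n - r) * y ^ r / fact (n - r))"
proof -
  have "(fact n :: real poly) = [:fact n:]"
    by (metis of_nat_fact of_nat_poly)
  then show ?thesis
    by (simp add: trunc_exp2_def poly_sum poly_monom sum_distrib_left mult_ac)
qed

definition trunc_exp2_at :: "nat \<Rightarrow> real poly \<Rightarrow> real poly poly" where
  "trunc_exp2_at n q = map_poly (\<lambda>c. pcompose c q) (trunc_exp2 n)"

end

theory Submission
  imports Defs
begin

text \<open>
  The geometric expansion of the rational amplitude is \<open>1 + 2 (\<Sum>j\<ge>1. (B_hat / 2)^j t^j)\<close>. One of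
  the two copies of the tail, together with the constant term, yields \<open>e_n\<close>; the other one, after
  extracting a factor \<open>B_hat / 2\<close> and shifting the index, yields the term with \<open>e_(n-1)\<close>.
\<close>

text \<open>Comparing coefficients after clearing the denominator gives a first order recursion with
  ratio \<open>B_hat / 2\<close>, so the series is geometric from index 1 on.\<close>

lemma fps_nth_pade11_amplitude_umbral:
  "fps_nth pade11_amplitude_umbral j =
     (if j = 0 then 1 else smult (2 * (1/2) ^ j) (B_hat ^ j))"
proof -
  let ?A = "pade11_amplitude_umbral" and ?h = "smult (1/2) B_hat"
  have "?A - fps_const ?h * (?A * fps_X) = 1 + fps_const ?h * fps_X"
    using pade11_amplitude_umbral_rational by (simp only: right_diff_distrib mult_1_right mult.left_commute)
  then have rel: "fps_nth ?A i - ?h * (if i = 0 then 0 else fps_nth ?A (i - 1)) =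
      (if i = 0 then 1 else if i = 1 then ?h else 0)" for i
    by (auto dest!: arg_cong[of _ _ "\<lambda>f. fps_nth f i"] split: if_splits)
  show ?thesis
  proof (induction j)
    case 0
    show ?case using rel[of 0] by simp
  next
    case (Suc j)
    \<comment> \<open>At \<open>j = 0\<close> the linear term of the numerator adds a second
      \<open>?h\<close>; this is the source of the factor 2.\<close>
    have eq: "fps_nth ?A (Suc j) = ?h * fps_nth ?A j + (if j = 0 then ?h else 0)"
      using rel[of "Suc j"] by (simp add: diff_eq_eq add.commute split: if_splits)
    show ?case
    proof (cases "j = 0")
      case True
      then show ?thesis using Suc eq by simp
    next
      case False
      have "?h * smult (2 * (1/2) ^ j) (B_hat ^ j) = smult (2 * (1/2) ^ Suc j) (B_hat ^ Suc j)"
        by (simp only: mult_smult_left mult_smult_right smult_smult power_Suc mult_ac)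
      then show ?thesis using False Suc eq by simp
    qed
  qed
qed

lemma umbral_eval_smult_B_hat_power: "umbral_eval (smult c (B_hat ^ r)) = c * bernoulli r"
  by (simp only: umbral_eval_smult umbral_eval_B_hat_power)

lemma fps_nth_pade11_amplitude:
  "fps_nth pade11_amplitude j = (if j = 0 then 1 else 2) * (1/2) ^ j * bernoulli j"
proof (cases "j = 0")
  case True
  then show ?thesis
    \<comment> \<open>The constant term 1 is read as \<open>B_hat ^ 0\<close>, so it evaluates to
      \<open>bernoulli 0\<close>.\<close>
    using umbral_eval_B_hat_power[of 0]
    by (simp add: pade11_amplitude_def fps_nth_pade11_amplitude_umbral)
next
  case False
  then show ?thesis
    by (simp only: pade11_amplitude_def fps_nth_Abs_fps fps_nth_pade11_amplitude_umbral
        umbral_eval_smult_B_hat_power if_False)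
qed

text \<open>Only the derivative of order \<open>n - k\<close> sends \<open>x^n\<close> to a multiple
  of \<open>x^k\<close>, so a single term of the operator series survives.\<close>

lemma coeff_apply_diff_series_monom:
  fixes A :: "'a::field_char_0 fps"
  shows "coeff (apply_diff_series A (monom 1 n)) k =
           (if k \<le> n then fps_nth A (n - k) * (fact n / fact k) else 0)"
proof -
  have "coeff (apply_diff_series A (monom 1 n)) k =
      (\<Sum>j\<le>n. if k + j = n then fps_nth A j * pochhammer (of_nat (Suc k)) j else 0)"
    by (auto simp: apply_diff_series_def degree_monom_eq coeff_sum coeff_higher_pderiv
        intro!: sum.cong)
  \<comment> \<open>Truncated subtraction makes \<open>n - k = 0\<close> for \<open>k > n\<close>,
    hence the inner guard \<open>k \<le> n\<close>.\<close>
  also have "\<dots> = (\<Sum>j\<le>n. if j = n - k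
      then (if k \<le> n then fps_nth A (n - k) * pochhammer (of_nat (Suc k)) (n - k) else 0) else 0)"
    by (intro sum.cong) auto
  also have "\<dots> = (if k \<le> n then fps_nth A (n - k) * pochhammer (of_nat (Suc k)) (n - k) else 0)"
    by simp
  also have "\<dots> = (if k \<le> n then fps_nth A (n - k) * (fact n / fact k) else 0)"
  proof -
    \<comment> \<open>The product \<open>(k+1) ... n\<close> is obtained by splitting
      \<open>n! = 1 ... n\<close> after the factor \<open>k\<close>.\<close>
    have "pochhammer (of_nat (Suc k)) (n - k) = (fact n / fact k :: 'a)" if "k \<le> n"
      using pochhammer_product[OF that, of "1::'a"]
      by (simp add: pochhammer_fact[symmetric] field_simps)
    then show ?thesis by simp
  qed
  finally show ?thesis .
qed

lemma coeff_trunc_exp2: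
  "coeff (trunc_exp2 n) k = (if k \<le> n then monom (fact n / fact k) (n - k) else 0)"
proof -
  have fact: "(fact n :: real poly) = [:fact n:]"
    by (metis of_nat_fact of_nat_poly)
  have "coeff (trunc_exp2 n) k =
      [:fact n:] * (\<Sum>r\<le>n. if n - r = k then monom (1 / fact (n - r)) r else 0)"
    by (simp add: trunc_exp2_def coeff_sum fact)
  also have "(\<Sum>r\<le>n. if n - r = k then monom (1 / fact (n - r) :: real) r else 0) =
      (\<Sum>r\<le>n. if r = n - k then (if k \<le> n then monom (1 / fact k) (n - k) else 0) else 0)"
    by (intro sum.cong) auto
  finally show ?thesis by (simp add: smult_monom)
qed

lemma coeff_trunc_exp2_at:
  "coeff (trunc_exp2_at n (smult (1/2) B_hat)) k =
     (if k \<le> n then smult (fact n / fact k * (1/2) ^ (n - k)) (B_hat ^ (n - k)) else 0)"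
proof -
  have "pcompose (monom c r) (smult (1/2) B_hat) = smult (c * (1/2) ^ r) (B_hat ^ r)" for c r
  proof -
    have "pcompose (monom c r) q = smult c (q ^ r)" for q
      by (induction r) (simp_all add: monom_0 monom_Suc pcompose_pCons)
    then show ?thesis by (simp only: smult_power smult_smult)
  qed
  then show ?thesis
    by (simp add: trunc_exp2_at_def coeff_map_poly coeff_trunc_exp2)
qed

lemma coeff_umbral_eval_poly: "coeff (umbral_eval_poly p) k = umbral_eval (coeff p k)"
  by (simp add: umbral_eval_poly_def coeff_map_poly)

theorem theorem7:
  fixes n :: nat
  shows "pade11_bernpoly n =
           umbral_eval_poly (trunc_exp2_at n (smult (1/2) B_hat)) +
           umbral_eval_poly (smult (smult (real n / 2) B_hat)
                                   (trunc_exp2_at (n - 1) (smult (1/2) B_hat)))"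
proof (rule poly_eqI)
  fix k
  let ?h = "smult (1/2) B_hat"
  have lhs: "coeff (pade11_bernpoly n) k = (if k \<le> n then
      (if k = n then 1 else 2) * (1/2) ^ (n - k) * bernoulli (n - k) * (fact n / fact k) else 0)"
    by (simp add: pade11_bernpoly_def coeff_apply_diff_series_monom fps_nth_pade11_amplitude)
  have first: "coeff (umbral_eval_poly (trunc_exp2_at n ?h)) k =
      (if k \<le> n then fact n / fact k * (1/2) ^ (n - k) * bernoulli (n - k) else 0)"
    by (simp only: coeff_umbral_eval_poly coeff_trunc_exp2_at umbral_eval_smult_B_hat_power
        umbral_eval_0 if_distrib[of umbral_eval])
  \<comment> \<open>Same value as in \<open>first\<close>, but without the case
    \<open>k = n\<close>: the sum doubles every coefficient except the leading one, as
    \<open>lhs\<close> requires.\<close>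
  have second: "coeff (umbral_eval_poly (smult (smult (real n / 2) B_hat)
        (trunc_exp2_at (n - 1) ?h))) k =
      (if k < n then fact n / fact k * (1/2) ^ (n - k) * bernoulli (n - k) else 0)"
  proof (cases "k < n")
    case True
    then obtain d where n: "n = k + Suc d" by (metis less_iff_Suc_add add_Suc_right)
    have "coeff (trunc_exp2_at (n - 1) ?h) k =
        smult (fact (n - 1) / fact k * (1/2) ^ d) (B_hat ^ d)"
      using n unfolding coeff_trunc_exp2_at by simp
    \<comment> \<open>The powers of \<open>B_hat\<close> are merged before evaluation, since
      \<open>umbral_eval\<close> is linear but not multiplicative.\<close>
    moreover have "smult (real n / 2) B_hat * smult c (B_hat ^ d) =
        smult (real n / 2 * c) (B_hat ^ Suc d)" for c
      by (simp only: mult_smult_left mult_smult_right smult_smult power_Suc mult_ac)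
    ultimately have "coeff (umbral_eval_poly (smult (smult (real n / 2) B_hat)
        (trunc_exp2_at (n - 1) ?h))) k =
        real n / 2 * (fact (n - 1) / fact k * (1/2) ^ d) * bernoulli (Suc d)"
      by (simp only: coeff_umbral_eval_poly coeff_smult umbral_eval_smult_B_hat_power)
    also have "\<dots> = fact n / fact k * (1/2) ^ Suc d * bernoulli (Suc d)"
      using n by (simp add: field_simps)
    finally show ?thesis using n by simp
  next
    case False
    \<comment> \<open>For \<open>n = 0\<close> the index \<open>n - 1\<close> is again 0, and the
      prefactor \<open>real n / 2 = 0\<close> removes the term; for \<open>n > 0\<close>,
      \<open>k\<close> exceeds the degree bound \<open>n - 1\<close>.\<close>
    then show ?thesis
      unfolding coeff_umbral_eval_poly coeff_smult coeff_trunc_exp2_at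
      by (cases "n = 0") simp_all
  qed
  show "coeff (pade11_bernpoly n) k = coeff (umbral_eval_poly (trunc_exp2_at n ?h) +
      umbral_eval_poly (smult (smult (real n / 2) B_hat) (trunc_exp2_at (n - 1) ?h))) k"
    unfolding coeff_add lhs first second by auto
qed

end
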